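(* Let $n \ge 3$, let $d_1, \ldots, d_n$ be integers with $d_i \ge 2$ for all $i$, let $k$ be a field of characteristic $p>0$, and let $A=k[x_1, \ldots, x_n]/(x_1^{d_1}, \ldots, x_n^{d_n})$. Let $t = \sum_{i = 1}^n (d_i-1)$ and assume $d_1=\max(d_1, \dots, d_n)$. Write $d_1=N_1p+r_1$ with $N_1$ an integer and $0<r_1\le p$. Then $A$ has the strong Lefschetz property if and only if one of the following two conditions holds: (1) $t <p$; (2) $d_1 > p$, $d_i \leq p$ for $i =2, \ldots, n$, and $\sum_{i=2}^n(d_i-1) \le \min(r_1,p-r_1)$.
   Context: $A$ is graded by degree, $A=\bigoplus_{i\ge 0}A_i$, with $A_i$ the image of the homogeneous polynomials of degree $i$. A linear map is said to have maximal rank if it is injective or surjective. A graded artinian algebra $A$ has the strong Lefschetz property (SLP) if there is a linear form $\ell\in A_1$ such that for all $i\ge 0$ and all $m\ge 1$ the map $A_i\to A_{i+m}$, $a\mapsto \ell^m a$, has maximal rank. *)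

theory Defs
  imports Main
begin

text \<open>Concrete model of the monomial complete intersection
  A = k[x_0,...,x_{n-1}] / (x_0^{d_0}, ..., x_{n-1}^{d_{n-1}}).
  The images of the monomials x^a with a_j < d_j form a k-basis of A, so an
  element of A is identified with its coefficient function on exponent vectors
  (supported on the standard monomials).  Variables are indexed 0..n-1
  (paper's x_1..x_n).\<close>

definition std_monos :: "nat \<Rightarrow> (nat \<Rightarrow> nat) \<Rightarrow> (nat \<Rightarrow> nat) set" where
  "std_monos n d = {a. (\<forall>j<n. a j < d j) \<and> (\<forall>j\<ge>n. a j = 0)}"

definition mono_deg :: "nat \<Rightarrow> (nat \<Rightarrow> nat) \<Rightarrow> nat" where
  "mono_deg n a = (\<Sum>j<n. a j)"

definition mci_graded :: "nat \<Rightarrow> (nat \<Rightarrow> nat) \<Rightarrow> nat \<Rightarrow> ((nat \<Rightarrow> nat) \<Rightarrow> 'a::field) set" where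
  "mci_graded n d i = {f. \<forall>a. f a \<noteq> 0 \<longrightarrow> a \<in> std_monos n d \<and> mono_deg n a = i}"

definition mci_mult_lin :: "nat \<Rightarrow> (nat \<Rightarrow> nat) \<Rightarrow> (nat \<Rightarrow> 'a::field)
    \<Rightarrow> ((nat \<Rightarrow> nat) \<Rightarrow> 'a) \<Rightarrow> ((nat \<Rightarrow> nat) \<Rightarrow> 'a)" where
  "mci_mult_lin n d l f = (\<lambda>c. if c \<in> std_monos n d
       then (\<Sum>j<n. if 1 \<le> c j then l j * f (c(j := c j - 1)) else 0) else 0)"

definition maximal_rank :: "('v \<Rightarrow> 'w) \<Rightarrow> 'v set \<Rightarrow> 'w set \<Rightarrow> bool" where
  "maximal_rank F V W \<longleftrightarrow> inj_on F V \<or> F ` V = W"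

definition mci_SLP :: "'a::field itself \<Rightarrow> nat \<Rightarrow> (nat \<Rightarrow> nat) \<Rightarrow> bool" where
  "mci_SLP _ n d \<longleftrightarrow> (\<exists>l :: nat \<Rightarrow> 'a. \<forall>i m. 1 \<le> m \<longrightarrow>
      maximal_rank (mci_mult_lin n d l ^^ m)
        (mci_graded n d i :: ((nat \<Rightarrow> nat) \<Rightarrow> 'a) set) (mci_graded n d (i + m)))"

end

theory Submission
  imports Defs Complex_Main "HOL-Library.Function_Algebras" "HOL-Computational_Algebra.Primes"
begin

text \<open>For q a power of the characteristic p, the q-th power of a linear form is a combination of
  the x_i^q.  Writing d_i - 1 = N_i q + u_i, a pigeonhole argument on the exponents shows that
  the strong Lefschetz property fails as soon as the numbers u_i, or max(u_i, q - 2 - u_i) for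
  those i with d_i > q, add up to at least q: for a suitable monomial of degree R the power t - 2R
  of every linear form annihilates it and misses its dual monomial.  Taking q = p (and q = 4 when
  p = 2) excludes everything but the two cases of the theorem.
  Conversely, multiplication by the sum of the variables is the raising operator of an sl2-action.
  If t < p, the usual primitive-vector argument shows that its power t - 2i is injective in
  degree i \<le> t/2, and this suffices by symmetry of the Hilbert function.  In the second case
  the p-th power of the linear form is x_1^p, which reduces the claim to the first case with d_1
  replaced by r_1.\<close>

section \<open>Commuting additive operators\<close>

lemma additive_of_nat_mult:
  fixes S :: "'v::comm_ring_1 \<Rightarrow> 'v"
  assumes "\<And>x y. S (x + y) = S x + S y"
  shows "S (of_nat k * x) = of_nat k * S x"
proof (induction k)
  case 0
  have "S 0 = S 0 + S 0" using assms[of 0 0] by simp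
  then show ?case by simp
qed (simp add: assms algebra_simps)

lemma additive_sum:
  fixes S :: "'v::comm_ring_1 \<Rightarrow> 'v"
  assumes "\<And>x y. S (x + y) = S x + S y"
  shows "S (sum f A) = (\<Sum>a\<in>A. S (f a))"
proof -
  have "S 0 = S 0 + S 0" using assms[of 0 0] by simp
  then show ?thesis
    by (induction A rule: infinite_finite_induct) (simp_all add: assms)
qed

lemma additive_funpow:
  fixes S :: "'v::comm_ring_1 \<Rightarrow> 'v"
  assumes "\<And>x y. S (x + y) = S x + S y"
  shows "(S ^^ m) (x + y) = (S ^^ m) x + (S ^^ m) y"
  by (induction m) (simp_all add: assms)

lemma commute_funpow:
  assumes "\<And>x. S (T x) = T (S x)"
  shows "S ((T ^^ m) x) = (T ^^ m) (S x)"
  by (induction m) (simp_all add: assms)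

text \<open>Powers here are iterated compositions. The ring structure on \<open>'v\<close> is the
  pointwise one on functions and serves to multiply vectors by integers.\<close>

lemma binomial_commuting_operators:
  fixes S T :: "'v::comm_ring_1 \<Rightarrow> 'v"
  assumes S: "\<And>x y. S (x + y) = S x + S y" and T: "\<And>x y. T (x + y) = T x + T y"
    and comm: "\<And>x. S (T x) = T (S x)"
  shows "((\<lambda>x. S x + T x) ^^ m) x = (\<Sum>k\<le>m. of_nat (m choose k) * (S ^^ k) ((T ^^ (m - k)) x))"
proof (induction m)
  case 0
  then show ?case by simp
next
  case (Suc m)
  define G where "G k j = (S ^^ k) ((T ^^ j) x)" for k j
  have SG: "S (G k j) = G (Suc k) j" for k j
    by (simp add: G_def)
  have TG: "T (G k j) = G k (Suc j)" for k j
    using commute_funpow[of T S k "(T ^^ j) x"] comm by (simp add: G_def)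
  have "((\<lambda>x. S x + T x) ^^ Suc m) x
      = S (\<Sum>k\<le>m. of_nat (m choose k) * G k (m - k)) + T (\<Sum>k\<le>m. of_nat (m choose k) * G k (m - k))"
    by (simp add: Suc G_def)
  also have "\<dots> = (\<Sum>k\<le>m. of_nat (m choose k) * G (Suc k) (m - k))
      + (\<Sum>k\<le>m. of_nat (m choose k) * G k (Suc (m - k)))"
    by (simp add: additive_sum[of S, OF S] additive_sum[of T, OF T]
        additive_of_nat_mult[of S, OF S] additive_of_nat_mult[of T, OF T] SG TG)
  \<comment> \<open>The added term at \<open>k = Suc m\<close> has coefficient 0. Splitting off
    \<open>k = 0\<close> aligns the two sums, and Pascal's rule merges them.\<close>
  also have "(\<Sum>k\<le>m. of_nat (m choose k) * G k (Suc (m - k)))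
      = (\<Sum>k\<le>Suc m. of_nat (m choose k) * G k (Suc m - k))"
    by (simp add: Suc_diff_le binomial_eq_0)
  also have "\<dots> = G 0 (Suc m) + (\<Sum>k\<le>m. of_nat (m choose Suc k) * G (Suc k) (m - k))"
    by (subst sum.atMost_Suc_shift) simp
  also have "(\<Sum>k\<le>m. of_nat (m choose k) * G (Suc k) (m - k))
      + (G 0 (Suc m) + (\<Sum>k\<le>m. of_nat (m choose Suc k) * G (Suc k) (m - k)))
      = G 0 (Suc m) + (\<Sum>k\<le>m. of_nat (Suc m choose Suc k) * G (Suc k) (m - k))"
    by (simp add: sum.distrib algebra_simps)
  also have "\<dots> = (\<Sum>k\<le>Suc m. of_nat (Suc m choose k) * G k (Suc m - k))"
    using sum.atMost_Suc_shift[of "\<lambda>k. of_nat (Suc m choose k) * G k (Suc m - k)" m] by simp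
  finally show ?case by (simp add: G_def)
qed

text \<open>In the binomial expansion \<open>p\<close> divides every middle coefficient, and
  multiples of \<open>p\<close> vanish in \<open>'v\<close>.\<close>

lemma frobenius_commuting_operators:
  fixes S T :: "'v::comm_ring_1 \<Rightarrow> 'v"
  assumes S: "\<And>x y. S (x + y) = S x + S y" and T: "\<And>x y. T (x + y) = T x + T y"
    and comm: "\<And>x. S (T x) = T (S x)"
    and p: "prime p" "of_nat p = (0::'v)"
  shows "((\<lambda>x. S x + T x) ^^ p) = (\<lambda>x. (S ^^ p) x + (T ^^ p) x)"
proof
  fix x
  have z: "of_nat (p choose k) = (0::'v)" if "0 < k" "k < p" for k
  proof -
    have "p dvd (p choose k)" using that p by (intro dvd_choose_prime) auto
    then show ?thesis using p(2) by (elim dvdE) simp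
  qed
  have "((\<lambda>x. S x + T x) ^^ p) x = (\<Sum>k\<le>p. of_nat (p choose k) * (S ^^ k) ((T ^^ (p - k)) x))"
    by (rule binomial_commuting_operators[of S T, OF S T comm])
  also have "\<dots> = (\<Sum>k\<in>{0,p}. of_nat (p choose k) * (S ^^ k) ((T ^^ (p - k)) x))"
    by (intro sum.mono_neutral_right) (auto simp: z)
  also have "\<dots> = (S ^^ p) x + (T ^^ p) x"
    using prime_gt_0_nat[OF p(1)] by (simp add: add.commute)
  finally show "((\<lambda>x. S x + T x) ^^ p) x = (S ^^ p) x + (T ^^ p) x" .
qed

lemma frobenius_power_commuting_operators:
  fixes S T :: "'v::comm_ring_1 \<Rightarrow> 'v"
  assumes S: "\<And>x y. S (x + y) = S x + S y" and T: "\<And>x y. T (x + y) = T x + T y"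
    and comm: "\<And>x. S (T x) = T (S x)"
    and p: "prime p" "of_nat p = (0::'v)"
  shows "((\<lambda>x. S x + T x) ^^ (p ^ e)) = (\<lambda>x. (S ^^ (p ^ e)) x + (T ^^ (p ^ e)) x)"
proof (induction e)
  case (Suc e)
  let ?q = "p ^ e"
  have "((\<lambda>x. S x + T x) ^^ (p ^ Suc e)) = (((\<lambda>x. S x + T x) ^^ ?q) ^^ p)"
    by (simp add: funpow_mult mult.commute)
  also have "\<dots> = ((\<lambda>x. (S ^^ ?q) x + (T ^^ ?q) x) ^^ p)"
    by (simp add: Suc)
  also have "\<dots> = (\<lambda>x. ((S ^^ ?q) ^^ p) x + ((T ^^ ?q) ^^ p) x)"
  proof (rule frobenius_commuting_operators[of "S ^^ ?q" "T ^^ ?q", OF _ _ _ p])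
    show "(S ^^ ?q) ((T ^^ ?q) x) = (T ^^ ?q) ((S ^^ ?q) x)" for x
      using commute_funpow[of "S ^^ ?q" T ?q x] commute_funpow[of T S ?q, symmetric] comm by simp
  qed (simp_all add: additive_funpow S T)
  finally show ?case by (simp add: funpow_mult mult.commute)
qed simp

lemma frobenius_sum_commuting_operators:
  fixes S :: "nat \<Rightarrow> 'v::comm_ring_1 \<Rightarrow> 'v"
  assumes S: "\<And>j x y. S j (x + y) = S j x + S j y"
    and comm: "\<And>i j x. S i (S j x) = S j (S i x)"
    and p: "prime p" "of_nat p = (0::'v)"
  shows "((\<lambda>x. \<Sum>j<n. S j x) ^^ (p ^ e)) = (\<lambda>x. \<Sum>j<n. (S j ^^ (p ^ e)) x)"
proof (induction n)
  case 0
  \<comment> \<open>The empty sum is the zero operator; its positive powers are zero while its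
    zeroth power is the identity, so positivity of \<open>p ^ e\<close> matters.\<close>
  have "((\<lambda>x::'v. 0::'v) ^^ Suc m) = (\<lambda>x. 0)" for m
    by (simp add: fun_eq_iff)
  from this[of "p ^ e - 1"] show ?case
    using p(1) by (simp add: prime_gt_0_nat)
next
  case (Suc n)
  have "((\<lambda>x. (\<Sum>j<n. S j x) + S n x) ^^ (p ^ e))
      = (\<lambda>x. ((\<lambda>x. \<Sum>j<n. S j x) ^^ (p ^ e)) x + (S n ^^ (p ^ e)) x)"
    by (rule frobenius_power_commuting_operators[of "\<lambda>x. \<Sum>j<n. S j x" "S n", OF _ _ _ p])
      (simp_all add: S sum.distrib additive_sum[of "S n", OF S] comm[of _ n])
  then show ?case by (simp add: Suc)
qed

section \<open>Injective maps between spaces of finitely supported functions\<close>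

text \<open>A dimension count. Injectivity keeps the images of the \<open>card S\<close> coordinate
  functions independent, and a target vector outside their span would give more than
  \<open>card T\<close> independent vectors in a space spanned by at most
  \<open>card T\<close>.\<close>

lemma injective_imp_surjective_finite_support:
  fixes F :: "('b \<Rightarrow> 'a::field) \<Rightarrow> ('c \<Rightarrow> 'a)"
  assumes add: "\<And>f g. F (f + g) = F f + F g"
    and scale: "\<And>c f. F (\<lambda>x. c * f x) = (\<lambda>x. c * F f x)"
    and fin: "finite S" "finite T" and card: "card T \<le> card S"
    and maps: "F ` {f. \<forall>x. f x \<noteq> 0 \<longrightarrow> x \<in> S} \<subseteq> {f. \<forall>x. f x \<noteq> 0 \<longrightarrow> x \<in> T}"
    and inj: "inj_on F {f. \<forall>x. f x \<noteq> 0 \<longrightarrow> x \<in> S}"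
  shows "F ` {f. \<forall>x. f x \<noteq> 0 \<longrightarrow> x \<in> S} = {f. \<forall>x. f x \<noteq> 0 \<longrightarrow> x \<in> T}"
proof -
  let ?sb = "\<lambda>(c::'a) (f::'b \<Rightarrow> 'a) x. c * f x"
  let ?sc = "\<lambda>(c::'a) (f::'c \<Rightarrow> 'a) x. c * f x"
  interpret vb: vector_space ?sb
    by unfold_locales (auto simp: fun_eq_iff algebra_simps)
  interpret vc: vector_space ?sc
    by unfold_locales (auto simp: fun_eq_iff algebra_simps)
  interpret F: Vector_Spaces.linear ?sb ?sc F
    by unfold_locales (simp_all add: add scale)
  define eb :: "'b \<Rightarrow> 'b \<Rightarrow> 'a" where "eb b = (\<lambda>x. of_bool (x = b))" for b
  define ec :: "'c \<Rightarrow> 'c \<Rightarrow> 'a" where "ec b = (\<lambda>x. of_bool (x = b))" for b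
  have injeb: "inj_on eb S"
    by (auto simp: inj_on_def eb_def fun_eq_iff of_bool_def split: if_splits)
  have suppb: "{f. \<forall>x. f x \<noteq> 0 \<longrightarrow> x \<in> S} = vb.span (eb ` S)"
  proof (intro equalityI subsetI)
    fix f :: "'b \<Rightarrow> 'a" assume f: "f \<in> {f. \<forall>x. f x \<noteq> 0 \<longrightarrow> x \<in> S}"
    have "f = (\<Sum>s\<in>S. ?sb (f s) (eb s))"
    proof
      fix x
      have "(\<Sum>s\<in>S. ?sb (f s) (eb s)) x = (\<Sum>s\<in>S. if s = x then f s else 0)"
        by (induction S rule: infinite_finite_induct) (auto simp: eb_def)
      also have "\<dots> = f x" using f fin by auto
      finally show "f x = (\<Sum>s\<in>S. ?sb (f s) (eb s)) x" by simp
    qed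
    also have "\<dots> \<in> vb.span (eb ` S)"
      by (intro vb.span_sum vb.span_scale vb.span_base) auto
    finally show "f \<in> vb.span (eb ` S)" .
  next
    fix f :: "'b \<Rightarrow> 'a" assume "f \<in> vb.span (eb ` S)"
    then show "f \<in> {f. \<forall>x. f x \<noteq> 0 \<longrightarrow> x \<in> S}"
      by (induction rule: vb.span_induct_alt) (auto simp: eb_def of_bool_def split: if_splits)
  qed
  have suppc: "f \<in> vc.span (ec ` T)" if f: "\<forall>x. f x \<noteq> 0 \<longrightarrow> x \<in> T" for f :: "'c \<Rightarrow> 'a"
  proof -
    have "f = (\<Sum>s\<in>T. ?sc (f s) (ec s))"
    proof
      fix x
      have "(\<Sum>s\<in>T. ?sc (f s) (ec s)) x = (\<Sum>s\<in>T. if s = x then f s else 0)"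
        by (induction T rule: infinite_finite_induct) (auto simp: ec_def)
      also have "\<dots> = f x" using f fin by auto
      finally show "f x = (\<Sum>s\<in>T. ?sc (f s) (ec s)) x" by simp
    qed
    also have "\<dots> \<in> vc.span (ec ` T)"
      by (intro vc.span_sum vc.span_scale vc.span_base) auto
    finally show ?thesis .
  qed
  have indep: "vb.independent (eb ` S)"
    unfolding vb.independent_explicit_finite_subsets
  proof (intro allI impI ballI)
    fix B u v assume B: "B \<subseteq> eb ` S" "finite B" "(\<Sum>v\<in>B. ?sb (u v) v) = 0" "v \<in> B"
    then obtain s where s: "s \<in> S" "v = eb s" by auto
    \<comment> \<open>Evaluating the relation at \<open>s\<close> isolates the coefficient of
      \<open>eb s\<close>.\<close>
    have "(\<Sum>v\<in>B. ?sb (u v) v) s = (\<Sum>w\<in>B. u w * w s)"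
      by (induction B rule: infinite_finite_induct) auto
    also have "\<dots> = (\<Sum>w\<in>B. if w = v then u w else 0)"
      using B s by (intro sum.cong) (auto simp: eb_def fun_eq_iff of_bool_def split: if_splits)
    also have "\<dots> = u v" using B by simp
    finally show "u v = 0" using B by simp
  qed
  have indF: "vc.independent (F ` eb ` S)"
    using indep inj unfolding suppb by (rule F.independent_inj_on_image)
  have cardF: "card (F ` eb ` S) = card S"
  proof -
    have "inj_on F (eb ` S)"
      using inj vb.span_superset[of "eb ` S"] unfolding suppb by (rule inj_on_subset)
    then show ?thesis by (simp add: card_image injeb)
  qed
  have "h \<in> F ` vb.span (eb ` S)" if h: "\<forall>x. h x \<noteq> 0 \<longrightarrow> x \<in> T" for h
  proof (rule ccontr)
    assume "h \<notin> F ` vb.span (eb ` S)"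
    then have nh: "h \<notin> vc.span (F ` eb ` S)" by (simp add: F.span_image)
    then have "vc.independent (insert h (F ` eb ` S))"
      using indF by (rule vc.independent_insertI)
    moreover have "insert h (F ` eb ` S) \<subseteq> vc.span (ec ` T)"
    proof -
      have "F (eb s) \<in> vc.span (ec ` T)" if "s \<in> S" for s
      proof (rule suppc)
        have "eb s \<in> {f. \<forall>x. f x \<noteq> 0 \<longrightarrow> x \<in> S}" using that by (auto simp: eb_def)
        then show "\<forall>x. F (eb s) x \<noteq> 0 \<longrightarrow> x \<in> T" using maps by blast
      qed
      then show ?thesis using suppc[OF h] by auto
    qed
    ultimately have "card (insert h (F ` eb ` S)) \<le> card (ec ` T)"
      using vc.independent_span_bound fin by blast
    also have "\<dots> \<le> card T" using fin(2) by (rule card_image_le)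
    finally have "card (insert h (F ` eb ` S)) \<le> card T" .
    moreover have "h \<notin> F ` eb ` S" using nh vc.span_base[of h "F ` eb ` S"] by argo
    ultimately show False using cardF card fin by simp
  qed
  then show ?thesis using maps unfolding suppb by auto
qed

section \<open>Multiplication by a linear form\<close>

lemma std_monos_le: "b \<in> std_monos n d" if "c \<in> std_monos n d" "\<And>j. b j \<le> c j"
  using that by (fastforce simp: std_monos_def intro: le_less_trans)

lemma std_monos_decrease: "c \<in> std_monos n d \<Longrightarrow> c(j := c j - k) \<in> std_monos n d"
  by (erule std_monos_le) auto

text \<open>Multiplication by the single term a x_j. The linear form is split into these operators
  so that the Frobenius identity for commuting operators applies.\<close>

definition mci_mult_var :: "nat \<Rightarrow> (nat \<Rightarrow> nat) \<Rightarrow> 'a::field \<Rightarrow> nat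
    \<Rightarrow> ((nat \<Rightarrow> nat) \<Rightarrow> 'a) \<Rightarrow> ((nat \<Rightarrow> nat) \<Rightarrow> 'a)" where
  "mci_mult_var n d a j f =
    (\<lambda>c. if c \<in> std_monos n d \<and> 1 \<le> c j then a * f (c(j := c j - 1)) else 0)"

lemma sum_fun_apply: "(\<Sum>j\<in>A. f j) x = (\<Sum>j\<in>A. f j x)"
  for f :: "'i \<Rightarrow> 'b \<Rightarrow> 'c::comm_monoid_add"
  by (induction A rule: infinite_finite_induct) auto

lemma mci_mult_lin_eq_sum: "mci_mult_lin n d l = (\<lambda>f. \<Sum>j<n. mci_mult_var n d (l j) j f)"
  by (auto simp: fun_eq_iff mci_mult_lin_def mci_mult_var_def sum_fun_apply intro!: sum.cong)

lemma mci_mult_var_add: "mci_mult_var n d a j (f + g) = mci_mult_var n d a j f + mci_mult_var n d a j g"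
  by (auto simp: mci_mult_var_def fun_eq_iff algebra_simps)

text \<open>Setting nonstandard coefficients to zero does no harm, since standard monomials stay
  standard when an exponent is lowered.\<close>

lemma mci_mult_var_commute:
  "mci_mult_var n d a i (mci_mult_var n d b j f) = mci_mult_var n d b j (mci_mult_var n d a i f)"
  by (cases "i = j")
    (auto simp: mci_mult_var_def fun_eq_iff fun_upd_twist std_monos_decrease algebra_simps
      simp del: One_nat_def)

text \<open>Stated for positive powers because the zeroth power is the identity and does not cut off
  coefficients outside \<open>std_monos n d\<close>.\<close>

lemma mci_mult_var_funpow_Suc:
  "(mci_mult_var n d a j ^^ Suc k) f =
    (\<lambda>c. if c \<in> std_monos n d \<and> Suc k \<le> c j then a ^ Suc k * f (c(j := c j - Suc k)) else 0)"
proof (induction k)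
  case 0
  then show ?case by (auto simp: mci_mult_var_def fun_eq_iff)
next
  case (Suc k)
  show ?case
    unfolding funpow.simps(2)[of "Suc k"] o_apply Suc
    by (auto simp: mci_mult_var_def fun_eq_iff std_monos_decrease)
qed

text \<open>In characteristic p the q-th power of the sum of the l_j x_j is the sum of the l_j^q
  x_j^q.\<close>

lemma mci_mult_lin_frobenius:
  fixes f :: "(nat \<Rightarrow> nat) \<Rightarrow> 'a::field"
  assumes "prime CHAR('a)" and q: "q = CHAR('a) ^ e"
  shows "(mci_mult_lin n d l ^^ q) f = (\<lambda>c. if c \<in> std_monos n d
    then (\<Sum>j<n. if q \<le> c j then l j ^ q * f (c(j := c j - q)) else 0) else 0)"
proof -
  have q1: "q = Suc (q - 1)" using assms by (simp add: prime_gt_0_nat)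
  have "(mci_mult_lin n d l ^^ q) f = (\<Sum>j<n. (mci_mult_var n d (l j) j ^^ q) f)"
    unfolding mci_mult_lin_eq_sum q
    by (intro fun_cong[OF frobenius_sum_commuting_operators]
        mci_mult_var_add mci_mult_var_commute assms(1)) (simp add: of_nat_fun zero_fun_def)
  also have "\<dots> = (\<Sum>j<n. (\<lambda>c. if c \<in> std_monos n d \<and> q \<le> c j
      then l j ^ q * f (c(j := c j - q)) else 0))"
    by (subst (1) q1, subst mci_mult_var_funpow_Suc, subst (1 2 3) q1) simp
  also have "\<dots> = (\<lambda>c. if c \<in> std_monos n d
    then (\<Sum>j<n. if q \<le> c j then l j ^ q * f (c(j := c j - q)) else 0) else 0)"
    by (auto simp: fun_eq_iff sum_fun_apply)
  finally show ?thesis .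
qed

lemma mci_mult_lin_add: "mci_mult_lin n d l (f + g) = mci_mult_lin n d l f + mci_mult_lin n d l g"
  by (auto simp: mci_mult_lin_def fun_eq_iff algebra_simps sum.distrib[symmetric] intro!: sum.cong)

lemma mci_mult_lin_scale:
  "mci_mult_lin n d l (\<lambda>x. a * f x) = (\<lambda>x. a * mci_mult_lin n d l f x)"
  by (auto simp: mci_mult_lin_def fun_eq_iff algebra_simps sum_distrib_left intro!: sum.cong)

lemma mci_mult_lin_funpow_add:
  "(mci_mult_lin n d l ^^ m) (f + g) = (mci_mult_lin n d l ^^ m) f + (mci_mult_lin n d l ^^ m) g"
  by (rule additive_funpow) (rule mci_mult_lin_add)

lemma mci_mult_lin_funpow_scale:
  "(mci_mult_lin n d l ^^ m) (\<lambda>x. a * f x) = (\<lambda>x. a * (mci_mult_lin n d l ^^ m) f x)"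
  by (induction m) (simp_all add: mci_mult_lin_scale)

lemma mci_mult_lin_0: "mci_mult_lin n d l 0 = 0"
  by (auto simp: mci_mult_lin_def fun_eq_iff intro!: sum.neutral)

lemma mci_mult_lin_funpow_0: "(mci_mult_lin n d l ^^ m) 0 = 0"
  by (induction m) (simp_all only: funpow.simps id_apply o_apply mci_mult_lin_0)

lemma zero_in_mci_graded: "0 \<in> mci_graded n d i"
  by (simp add: mci_graded_def)

lemma mono_deg_upd: "j < n \<Longrightarrow> mono_deg n (c(j := x)) + c j = mono_deg n c + x"
  by (simp add: mono_deg_def sum.remove[of "{..<n}" j])

lemma mci_mult_lin_graded:
  assumes "f \<in> mci_graded n d i"
  shows "mci_mult_lin n d l f \<in> mci_graded n d (Suc i)"
proof -
  have "c \<in> std_monos n d \<and> mono_deg n c = Suc i" if nz: "mci_mult_lin n d l f c \<noteq> 0" for c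
  proof -
    have c: "c \<in> std_monos n d" using nz by (auto simp: mci_mult_lin_def split: if_splits)
    then obtain j where j: "j < n" "1 \<le> c j" "f (c(j := c j - 1)) \<noteq> 0"
      using nz by (auto simp: mci_mult_lin_def elim!: sum.not_neutral_contains_not_neutral split: if_splits)
    then have "mono_deg n (c(j := c j - 1)) = i" using assms by (auto simp: mci_graded_def)
    then show ?thesis using mono_deg_upd[OF j(1), of c "c j - 1"] j c by simp
  qed
  then show ?thesis by (simp add: mci_graded_def)
qed

lemma mci_mult_lin_funpow_graded:
  assumes "f \<in> mci_graded n d i"
  shows "(mci_mult_lin n d l ^^ m) f \<in> mci_graded n d (i + m)"
  by (induction m) (simp_all add: assms mci_mult_lin_graded)

section \<open>An obstruction to the strong Lefschetz property\<close>

text \<open>Each application of the q-th power raises a single exponent by \<open>q\<close>, so a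
  monomial reached after \<open>M\<close> applications lies \<open>M\<close> blocks of size
  \<open>q\<close> above some monomial of \<open>g\<close>.\<close>

lemma mci_mult_lin_frobenius_support:
  fixes g :: "(nat \<Rightarrow> nat) \<Rightarrow> 'a::field"
  assumes p: "prime CHAR('a)" and q: "q = CHAR('a) ^ e"
    and nz: "((mci_mult_lin n d l ^^ q) ^^ M) g c \<noteq> 0"
  shows "\<exists>b. g b \<noteq> 0 \<and> (\<forall>j. b j \<le> c j) \<and> M \<le> (\<Sum>j<n. (c j - b j) div q)"
  using nz
proof (induction M arbitrary: c)
  case 0
  then show ?case by auto
next
  case (Suc M)
  let ?L = "mci_mult_lin n d l ^^ q"
  have q0: "0 < q" using p q by (simp add: prime_gt_0_nat)
  from Suc.prems have nz: "?L ((?L ^^ M) g) c \<noteq> 0" by simp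
  then obtain j where j: "j < n" "q \<le> c j" "(?L ^^ M) g (c(j := c j - q)) \<noteq> 0"
    unfolding mci_mult_lin_frobenius[OF p q]
    by (auto elim!: sum.not_neutral_contains_not_neutral split: if_splits)
  from Suc.IH[OF j(3)] obtain b where b: "g b \<noteq> 0" "\<And>i. b i \<le> (c(j := c j - q)) i"
    "M \<le> (\<Sum>i<n. ((c(j := c j - q)) i - b i) div q)" by blast
  \<comment> \<open>Since \<open>b j \<le> c j - q\<close>, no subtraction is truncated and
    coordinate \<open>j\<close> gains exactly one block.\<close>
  have "(c j - b j) div q = ((c j - q - b j) + q) div q"
    using b(2)[of j] j by (intro arg_cong[of _ _ "\<lambda>x. x div q"]) simp
  also have "\<dots> = (c j - q - b j) div q + 1" using q0 by simp
  finally have "(c j - b j) div q = (c j - q - b j) div q + 1" .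
  then have "(\<Sum>i<n. (c i - b i) div q) = Suc (\<Sum>i<n. ((c(j := c j - q)) i - b i) div q)"
    using j(1) by (simp add: sum.remove[of "{..<n}" j])
  moreover have "b i \<le> c i" for i using b(2)[of i] by (auto split: if_splits)
  ultimately show ?case using b by (intro exI[of _ b]) auto
qed

text \<open>Let a i be the residue of d i modulo q if q < d i and that residue is less than q/2, and 0
  otherwise.  A power M of the q-th power of the linear form would have to raise the exponents of the
  monomial x^a in M blocks of size q, and only M - 1 of them fit below d; read backwards, the
  same count shows that the dual monomial x^(d-1-a) is missing from the image.\<close>

lemma not_mci_SLP_if_residues_large:
  fixes d u w :: "nat \<Rightarrow> nat"
  assumes p: "prime CHAR('a::field)" and q: "q = CHAR('a) ^ e"
    and d: "\<And>i. i < n \<Longrightarrow> 1 \<le> d i"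
    and u: "\<And>i. u i = (d i - 1) mod q"
    and w: "\<And>i. w i = (if d i \<le> q then u i else max (u i) (q - 2 - u i))"
    and large: "q \<le> (\<Sum>i<n. w i)"
  shows "\<not> mci_SLP TYPE('a) n d"
proof
  assume "mci_SLP TYPE('a) n d"
  then obtain l :: "nat \<Rightarrow> 'a" where l: "\<And>i m. 1 \<le> m \<Longrightarrow>
      maximal_rank (mci_mult_lin n d l ^^ m) (mci_graded n d i) (mci_graded n d (i + m))"
    unfolding mci_SLP_def by blast
  let ?E = "mci_mult_lin n d l"
  have q0: "0 < q" using p q by (simp add: prime_gt_0_nat)
  define a where "a i = (if i < n \<and> q < d i \<and> u i < q - 2 - u i then u i + 1 else 0)" for i
  \<comment> \<open>\<open>w i\<close> is what remains of \<open>d i - 1\<close> after removing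
    \<open>a i\<close> twice, once for the monomial and once for its dual, and all q-blocks that fit
    above \<open>a i\<close>.\<close>
  have key: "d i - 1 = 2 * a i + q * ((d i - 1 - a i) div q) + w i" if "i < n" for i
  proof (cases "q < d i \<and> u i < q - 2 - u i")
    case True
    define N where "N = (d i - 1) div q"
    have dN: "d i - 1 = N * q + u i" by (simp add: N_def u)
    have "1 \<le> N" unfolding N_def using True q0 by (simp add: Suc_le_eq div_greater_zero_iff le_diff_conv2)
    then obtain N' where N': "N = Suc N'" by (cases N) auto
    have ai: "a i = u i + 1" using True that by (simp add: a_def)
    \<comment> \<open>Starting at \<open>u i + 1\<close>, just past the residue, costs one whole
      block and leaves the largest possible remainder.\<close>
    have "d i - 1 - a i = q * N' + (q - 1)" using dN ai N' q0 by (simp add: algebra_simps)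
    then have e1: "(d i - 1 - a i) div q = N'" using q0 by (simp only: div_mult_self4) simp
    have "w i = q - 2 - u i" using True by (simp add: w)
    moreover have "d i - 1 = q * N' + q + u i" using dN N' by (simp add: algebra_simps)
    ultimately show ?thesis unfolding e1 using ai True by linarith
  next
    case False
    then have "w i = u i" "a i = 0" by (auto simp: w a_def)
    then show ?thesis by (simp add: u)
  qed
  define R where "R = (\<Sum>i<n. a i)"
  define M where "M = Suc (\<Sum>i<n. (d i - 1 - a i) div q)"
  define t where "t = (\<Sum>i<n. d i - 1)"
  have "t = (\<Sum>i<n. 2 * a i + q * ((d i - 1 - a i) div q) + w i)"
    unfolding t_def by (intro sum.cong refl key) simp
  then have t: "t = 2 * R + q * (M - 1) + (\<Sum>i<n. w i)"
    by (simp add: R_def M_def sum.distrib sum_distrib_left)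
  \<comment> \<open>The hypothesis \<open>large\<close> makes \<open>q * M \<le> t - 2 * R\<close>;
    the remaining power \<open>h\<close> leads to degree \<open>t - R\<close>, that of the dual
    monomial.\<close>
  define h where "h = t - 2 * R - q * M"
  have m: "t = 2 * R + (q * M + h)" unfolding h_def using t large by (simp add: M_def)
  \<comment> \<open>The Frobenius factor is applied first to show that the monomial is annihilated,
    and last to show that the dual monomial is missed.\<close>
  have split1: "?E ^^ (q * M + h) = (?E ^^ h) \<circ> ((?E ^^ q) ^^ M)"
    using funpow_add[of h "q * M" ?E] by (simp add: funpow_mult mult.commute[of M] add.commute[of h])
  have split2: "?E ^^ (q * M + h) = ((?E ^^ q) ^^ M) \<circ> (?E ^^ h)"
    by (simp add: funpow_mult mult.commute funpow_add)
  have al: "a i \<le> d i - 1" if "i < n" for i using key[OF that] by simp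
  have astd: "a \<in> std_monos n d"
    unfolding std_monos_def
  proof (intro CollectI conjI allI impI)
    show "a i < d i" if "i < n" for i using al[OF that] d[OF that] by linarith
  qed (simp add: a_def)
  define a' where "a' i = (if i < n then d i - 1 - a i else 0)" for i
  have a'std: "a' \<in> std_monos n d"
    unfolding std_monos_def
  proof (intro CollectI conjI allI impI)
    show "a' i < d i" if "i < n" for i using d[OF that] that by (auto simp: a'_def)
  qed (simp add: a'_def)
  have "(\<Sum>i<n. a' i) + (\<Sum>i<n. a i) = t"
    unfolding t_def sum.distrib[symmetric]
  proof (intro sum.cong refl)
    show "a' i + a i = d i - 1" if "i \<in> {..<n}" for i using al[of i] that by (simp add: a'_def)
  qed
  then have a'deg: "mono_deg n a' = R + (q * M + h)"
    using m by (simp add: mono_deg_def R_def)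
  let ?x = "\<lambda>b. of_bool (b = a) :: 'a"
  have xA: "?x \<in> mci_graded n d R" using astd by (auto simp: mci_graded_def mono_deg_def R_def)
  have "((?E ^^ q) ^^ M) ?x = 0"
  proof (rule ccontr)
    assume "((?E ^^ q) ^^ M) ?x \<noteq> 0"
    then obtain c where c: "((?E ^^ q) ^^ M) ?x c \<noteq> 0" by (auto simp: fun_eq_iff)
    \<comment> \<open>\<open>M\<close> is positive, so at least one multiplication takes place and
      forces \<open>c\<close> to be standard.\<close>
    then have "((?E ^^ q) ^^ Suc (M - 1)) ?x c \<noteq> 0" by (simp add: M_def)
    then have "c \<in> std_monos n d"
      unfolding funpow.simps(2) o_apply mci_mult_lin_frobenius[OF p q] by (auto split: if_splits)
    then have cd: "c i \<le> d i - 1" if "i < n" for i using that by (fastforce simp: std_monos_def)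
    from mci_mult_lin_frobenius_support[OF p q c]
    have "M \<le> (\<Sum>j<n. (c j - a j) div q)" by auto
    also have "\<dots> \<le> (\<Sum>j<n. (d j - 1 - a j) div q)"
      using cd by (intro sum_mono div_le_mono diff_le_mono) auto
    finally show False by (simp add: M_def)
  qed
  then have "(?E ^^ (q * M + h)) ?x = (?E ^^ (q * M + h)) 0"
    unfolding mci_mult_lin_funpow_0 by (simp add: split1 mci_mult_lin_funpow_0)
  moreover have "?x \<noteq> 0" by (auto simp: fun_eq_iff)
  ultimately have ninj: "\<not> inj_on (?E ^^ (q * M + h)) (mci_graded n d R)"
    using xA zero_in_mci_graded by (metis inj_onD)
  have van: "(?E ^^ (q * M + h)) g a' = 0" for g
  proof (rule ccontr)
    assume "(?E ^^ (q * M + h)) g a' \<noteq> 0"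
    then have "((?E ^^ q) ^^ M) ((?E ^^ h) g) a' \<noteq> 0" by (simp add: split2)
    from mci_mult_lin_frobenius_support[OF p q this] obtain b where
      "M \<le> (\<Sum>j<n. (a' j - b j) div q)" by blast
    also have "\<dots> \<le> (\<Sum>j<n. (d j - 1 - a j) div q)"
      by (intro sum_mono div_le_mono) (auto simp: a'_def)
    finally show False by (simp add: M_def)
  qed
  let ?y = "\<lambda>b. of_bool (b = a') :: 'a"
  have "?y \<in> mci_graded n d (R + (q * M + h))"
    using a'std a'deg by (auto simp: mci_graded_def)
  moreover have "?y \<notin> (?E ^^ (q * M + h)) ` mci_graded n d R"
    using van by (metis (mono_tags, lifting) imageE of_bool_eq(2) zero_neq_one)
  ultimately have "\<not> maximal_rank (?E ^^ (q * M + h)) (mci_graded n d R) (mci_graded n d (R + (q * M + h)))"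
    using ninj by (auto simp: maximal_rank_def)
  moreover have "1 \<le> q * M + h" using q0 by (simp add: M_def)
  ultimately show False using l by blast
qed

section \<open>Maximal rank from injectivity up to the middle degree\<close>

lemma finite_std_monos: "finite (std_monos n d)"
proof (rule finite_subset)
  show "std_monos n d \<subseteq> {a. \<forall>j. (j \<in> {..<n} \<longrightarrow> a j \<in> {..<Suc (\<Sum>i<n. d i)}) \<and> (j \<notin> {..<n} \<longrightarrow> a j = 0)}"
  proof
    fix a assume a: "a \<in> std_monos n d"
    have "a j < Suc (\<Sum>i<n. d i)" if "j < n" for j
    proof -
      have "a j < d j" using a that by (simp add: std_monos_def)
      also have "d j \<le> (\<Sum>i<n. d i)" using that by (intro member_le_sum) auto
      finally show ?thesis by simp
    qed
    then show "a \<in> {a. \<forall>j. (j \<in> {..<n} \<longrightarrow> a j \<in> {..<Suc (\<Sum>i<n. d i)}) \<and> (j \<notin> {..<n} \<longrightarrow> a j = 0)}"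
      using a by (auto simp: std_monos_def)
  qed
qed (rule finite_set_of_finite_funs; simp)

definition std_monos_deg :: "nat \<Rightarrow> (nat \<Rightarrow> nat) \<Rightarrow> nat \<Rightarrow> (nat \<Rightarrow> nat) set" where
  "std_monos_deg n d i = {a \<in> std_monos n d. mono_deg n a = i}"

lemma finite_std_monos_deg: "finite (std_monos_deg n d i)"
  by (simp add: std_monos_deg_def finite_std_monos)

lemma mci_graded_eq_support: "mci_graded n d i = {f. \<forall>x. f x \<noteq> 0 \<longrightarrow> x \<in> std_monos_deg n d i}"
  by (simp add: mci_graded_def std_monos_deg_def)

lemma mono_deg_le_socle:
  assumes "a \<in> std_monos n d"
  shows "mono_deg n a \<le> (\<Sum>j<n. d j - 1)"
  unfolding mono_deg_def using assms by (intro sum_mono) (fastforce simp: std_monos_def)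

text \<open>Complementing exponents to \<open>d j - 1 - a j\<close> exchanges degrees
  \<open>i\<close> and \<open>t - i\<close>: the symmetry of the Hilbert function.\<close>

lemma card_std_monos_deg_complement:
  assumes t: "t = (\<Sum>j<n. d j - 1)" and i: "i \<le> t"
  shows "card (std_monos_deg n d (t - i)) \<le> card (std_monos_deg n d i)"
proof (rule card_inj_on_le)
  let ?h = "\<lambda>a j. if j < n then d j - 1 - a j else 0"
  show "inj_on ?h (std_monos_deg n d (t - i))"
  proof (intro inj_onI ext)
    fix a b j assume ab: "a \<in> std_monos_deg n d (t - i)" "b \<in> std_monos_deg n d (t - i)" "?h a = ?h b"
    show "a j = b j"
    proof (cases "j < n")
      case True
      then have "d j - 1 - a j = d j - 1 - b j" using fun_cong[OF ab(3), of j] by simp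
      moreover have "a j < d j" "b j < d j"
        using ab True by (auto simp: std_monos_deg_def std_monos_def)
      ultimately show ?thesis by linarith
    qed (use ab in \<open>auto simp: std_monos_deg_def std_monos_def\<close>)
  qed
  show "?h ` std_monos_deg n d (t - i) \<subseteq> std_monos_deg n d i"
  proof (intro image_subsetI)
    fix a assume a: "a \<in> std_monos_deg n d (t - i)"
    then have lt: "a j < d j" if "j < n" for j using that by (simp add: std_monos_deg_def std_monos_def)
    have "(\<Sum>j<n. ?h a j) + (\<Sum>j<n. a j) = t"
      unfolding t sum.distrib[symmetric] using lt by (intro sum.cong) fastforce+
    moreover have "(\<Sum>j<n. a j) = t - i" using a by (simp add: std_monos_deg_def mono_deg_def)
    ultimately have "mono_deg n (?h a) = i" using i by (simp add: mono_deg_def)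
    moreover have "?h a \<in> std_monos n d" using lt by (fastforce simp: std_monos_def)
    ultimately show "?h a \<in> std_monos_deg n d i" by (simp add: std_monos_deg_def)
  qed
qed (rule finite_std_monos_deg)

lemma mci_mult_lin_funpow_inj_on:
  assumes "\<And>v. v \<in> mci_graded n d i \<Longrightarrow> (mci_mult_lin n d l ^^ m) v = 0 \<Longrightarrow> v = 0"
  shows "inj_on (mci_mult_lin n d l ^^ m) (mci_graded n d i)"
proof (rule inj_onI)
  fix f g assume fg: "f \<in> mci_graded n d i" "g \<in> mci_graded n d i"
    "(mci_mult_lin n d l ^^ m) f = (mci_mult_lin n d l ^^ m) g"
  \<comment> \<open>The difference is written with the scalar -1 so that additivity and scaling
    apply to it.\<close>
  let ?h = "f + (\<lambda>x. - 1 * g x)"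
  have "?h \<in> mci_graded n d i" using fg(1,2) unfolding mci_graded_def by auto (metis add.right_neutral neg_equal_0_iff_equal)+
  moreover have "(mci_mult_lin n d l ^^ m) ?h = 0"
    unfolding mci_mult_lin_funpow_add mci_mult_lin_funpow_scale fg(3) by (simp add: fun_eq_iff)
  ultimately have "?h = 0" by (rule assms)
  then show "f = g" by (simp add: fun_eq_iff)
qed

lemma mci_mult_lin_funpow_surj:
  assumes "\<And>v. v \<in> mci_graded n d i \<Longrightarrow> (mci_mult_lin n d l ^^ m) v = 0 \<Longrightarrow> v = 0"
    and "card (std_monos_deg n d (i + m)) \<le> card (std_monos_deg n d i)"
  shows "(mci_mult_lin n d l ^^ m) ` mci_graded n d i = mci_graded n d (i + m)"
  unfolding mci_graded_eq_support
proof (rule injective_imp_surjective_finite_support)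
  show "(mci_mult_lin n d l ^^ m) ` {f. \<forall>x. f x \<noteq> 0 \<longrightarrow> x \<in> std_monos_deg n d i}
      \<subseteq> {f. \<forall>x. f x \<noteq> 0 \<longrightarrow> x \<in> std_monos_deg n d (i + m)}"
    unfolding mci_graded_eq_support[symmetric] by (auto intro: mci_mult_lin_funpow_graded)
  show "inj_on (mci_mult_lin n d l ^^ m) {f. \<forall>x. f x \<noteq> 0 \<longrightarrow> x \<in> std_monos_deg n d i}"
    unfolding mci_graded_eq_support[symmetric] using assms(1) by (rule mci_mult_lin_funpow_inj_on)
qed (simp_all add: mci_mult_lin_funpow_add mci_mult_lin_funpow_scale finite_std_monos_deg assms(2))

text \<open>Up to the middle, the power \<open>m\<close> is the first factor of the injective power
  \<open>t - 2 * i\<close>. Beyond it, it is the last factor of a surjection between complementary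
  degrees. Past degree \<open>t\<close> the target is zero.\<close>

lemma mci_SLP_if_injective:
  fixes l :: "nat \<Rightarrow> 'a::field"
  assumes t: "t = (\<Sum>j<n. d j - 1)"
    and ker: "\<And>i v. 2 * i \<le> t \<Longrightarrow> v \<in> mci_graded n d i
      \<Longrightarrow> (mci_mult_lin n d l ^^ (t - 2 * i)) v = 0 \<Longrightarrow> v = 0"
  shows "mci_SLP TYPE('a) n d"
  unfolding mci_SLP_def
proof (intro exI[of _ l] allI impI)
  fix i m :: nat assume "1 \<le> m"
  let ?E = "mci_mult_lin n d l"
  consider "2 * i + m \<le> t" | "t < 2 * i + m" "i + m \<le> t" | "t < i + m" by linarith
  then show "maximal_rank (?E ^^ m) (mci_graded n d i) (mci_graded n d (i + m))"
  proof cases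
    case 1
    have "inj_on (?E ^^ m) (mci_graded n d i)"
    proof (rule mci_mult_lin_funpow_inj_on)
      fix v assume v: "v \<in> mci_graded n d i" "(?E ^^ m) v = 0"
      have "t - 2 * i = (t - 2 * i - m) + m" using 1 by simp
      then have "(?E ^^ (t - 2 * i)) v = (?E ^^ (t - 2 * i - m)) ((?E ^^ m) v)"
        by (metis funpow_add o_apply)
      then show "v = 0" using ker[of i v] v 1 by (simp add: mci_mult_lin_funpow_0)
    qed
    then show ?thesis by (simp add: maximal_rank_def)
  next
    case 2
    \<comment> \<open>\<open>j\<close> is complementary to the target degree, and the surjection
      from degree \<open>j\<close> to degree \<open>t - j\<close> passes through degree
      \<open>i\<close>.\<close>
    define j where "j = t - (i + m)"
    have j: "2 * j \<le> t" "j \<le> i" "t - 2 * j = m + (i - j)" "j + (t - 2 * j) = i + m" "t - j = i + m" "j \<le> t"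
      using 2 by (auto simp: j_def)
    have "(?E ^^ (t - 2 * j)) ` mci_graded n d j = mci_graded n d (j + (t - 2 * j))"
    proof (rule mci_mult_lin_funpow_surj)
      show "card (std_monos_deg n d (j + (t - 2 * j))) \<le> card (std_monos_deg n d j)"
        using card_std_monos_deg_complement[OF t j(6)] j(4,5) by simp
    qed (use ker j(1) in blast)
    then have onto: "(?E ^^ m) ` ((?E ^^ (i - j)) ` mci_graded n d j) = mci_graded n d (i + m)"
      unfolding j(3)[unfolded j(4)] image_comp funpow_add[symmetric] using j(3,4) by (simp add: add.commute)
    have "(?E ^^ (i - j)) ` mci_graded n d j \<subseteq> mci_graded n d i"
      using mci_mult_lin_funpow_graded[of _ n d j "i - j" l] j(2) by auto
    then have "(?E ^^ m) ` mci_graded n d i = mci_graded n d (i + m)"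
      using onto mci_mult_lin_funpow_graded[of _ n d i m l] by blast
    then show ?thesis by (simp add: maximal_rank_def)
  next
    case 3
    have "mci_graded n d (i + m) = ({0} :: ((nat \<Rightarrow> nat) \<Rightarrow> 'a) set)"
      using mono_deg_le_socle[of _ n d] 3 t by (auto simp: mci_graded_def fun_eq_iff) fastforce
    then have "(?E ^^ m) ` mci_graded n d i = mci_graded n d (i + m)"
      using mci_mult_lin_funpow_graded[of _ n d i m l] zero_in_mci_graded[of n d i]
        mci_mult_lin_funpow_0[of m n d l] by auto
    then show ?thesis by (simp add: maximal_rank_def)
  qed
qed

section \<open>Small socle degree\<close>

text \<open>On k[x]/(x^d) this is the lowering operator of the irreducible sl2-module of
  dimension d with raising operator x; on A it is the induced operator on the tensor product.\<close>

definition mci_lower :: "nat \<Rightarrow> (nat \<Rightarrow> nat) \<Rightarrow> ((nat \<Rightarrow> nat) \<Rightarrow> 'a::field) \<Rightarrow> ((nat \<Rightarrow> nat) \<Rightarrow> 'a)" where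
  "mci_lower n d f = (\<lambda>c. if c \<in> std_monos n d
    then (\<Sum>j<n. of_nat ((c j + 1) * (d j - 1 - c j)) * f (c(j := c j + 1))) else 0)"

lemma mci_lower_0: "mci_lower n d 0 = 0"
  by (auto simp: mci_lower_def fun_eq_iff)

lemma std_monos_increase:
  assumes "c \<in> std_monos n d" "j < n" "c j + k < d j"
  shows "c(j := c j + k) \<in> std_monos n d"
  using assms by (auto simp: std_monos_def)

text \<open>The sl2 relation: the commutator acts on degree i as the weight t - 2i. Terms in two
  distinct variables cancel, and variable j contributes (c_j + 1)(d_j - 1 - c_j) - c_j (d_j - c_j) =
  d_j - 1 - 2 c_j.\<close>

lemma mci_lower_mult_lin_commutator:
  fixes f :: "(nat \<Rightarrow> nat) \<Rightarrow> 'a::field"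
  assumes c: "c \<in> std_monos n d"
  shows "mci_lower n d (mci_mult_lin n d (\<lambda>_. 1) f) c = mci_mult_lin n d (\<lambda>_. 1) (mci_lower n d f) c
    + (of_nat (\<Sum>j<n. d j - 1) - 2 * of_nat (mono_deg n c)) * f c"
proof -
  define P where "P j i = of_nat ((c j + 1) * (d j - 1 - c j)) *
    (if 1 \<le> (c(j := c j + 1)) i then f ((c(j := c j + 1))(i := (c(j := c j + 1)) i - 1)) else 0)" for i j
  define Q where "Q i j = (if 1 \<le> c i then of_nat (((c(i := c i - 1)) j + 1) * (d j - 1 - (c(i := c i - 1)) j))
    * f ((c(i := c i - 1))(j := (c(i := c i - 1)) j + 1)) else 0)" for i j
  have "mci_lower n d (mci_mult_lin n d (\<lambda>_. 1) f) c = (\<Sum>j<n. \<Sum>i<n. P j i)"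
  proof -
    have "of_nat ((c j + 1) * (d j - 1 - c j)) * mci_mult_lin n d (\<lambda>_. 1) f (c(j := c j + 1))
      = (\<Sum>i<n. P j i)" if j: "j < n" for j
    proof (cases "c j + 1 < d j")
      case True
      show ?thesis using std_monos_increase[OF c j True]
        unfolding mci_mult_lin_def P_def by (simp only: if_True sum_distrib_left mult_1_left)
    next
      \<comment> \<open>At the top exponent the raised monomial is not standard, but the factor
        \<open>d j - 1 - c j\<close> vanishes.\<close>
      case False
      then have "(c j + 1) * (d j - 1 - c j) = 0" by simp
      then show ?thesis unfolding P_def by (simp only: of_nat_0 mult_zero_left sum.neutral_const)
    qed
    then show ?thesis unfolding mci_lower_def using c by (simp del: fun_upd_apply of_nat_mult)
  qed
  also have "P j i = Q i j + (if i = j then (of_nat (d j - 1) - 2 * of_nat (c j)) * f c else 0)"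
    if "i < n" "j < n" for i j
  proof (cases "i = j")
    case True
    have "c j < d j" using c that by (simp add: std_monos_def)
    then obtain k where k: "d j = Suc (c j + k)" using less_iff_Suc_add by auto
    show ?thesis
    proof (cases "c j")
      case 0
      then have "c(j := 0) = c" by auto
      then show ?thesis using 0 True k by (simp add: P_def Q_def algebra_simps)
    next
      case (Suc b)
      have "c(j := Suc b) = c" using Suc by auto
      then show ?thesis using True k Suc by (simp add: P_def Q_def algebra_simps)
    qed
  next
    case False
    then show ?thesis by (simp add: P_def Q_def fun_upd_twist[OF False])
  qed
  then have "(\<Sum>j<n. \<Sum>i<n. P j i) = (\<Sum>j<n. \<Sum>i<n. Q i j
      + (if i = j then (of_nat (d j - 1) - 2 * of_nat (c j)) * f c else 0))"
    by (intro sum.cong) auto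
  also have "\<dots> = (\<Sum>j<n. \<Sum>i<n. Q i j) + (\<Sum>j<n. (of_nat (d j - 1) - 2 * of_nat (c j)) * f c)"
    by (simp add: sum.distrib)
  also have "(\<Sum>j<n. \<Sum>i<n. Q i j) = (\<Sum>i<n. \<Sum>j<n. Q i j)" by (rule sum.swap)
  also have "\<dots> = mci_mult_lin n d (\<lambda>_. 1) (mci_lower n d f) c"
    unfolding mci_mult_lin_def mci_lower_def Q_def using c std_monos_decrease[OF c, of _ 1]
    by (auto simp del: fun_upd_apply of_nat_mult intro!: sum.cong)
  also have "(\<Sum>j<n. (of_nat (d j - 1) - 2 * of_nat (c j)) * f c)
      = (of_nat (\<Sum>j<n. d j - 1) - 2 * of_nat (mono_deg n c)) * f c"
    by (simp add: mono_deg_def sum_subtractf sum_distrib_left sum_distrib_right algebra_simps)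
  finally show ?thesis .
qed

lemma mci_lower_graded:
  assumes "f \<in> mci_graded n d i" "mci_lower n d f c \<noteq> 0"
  shows "c \<in> std_monos n d \<and> Suc (mono_deg n c) = i"
proof -
  have c: "c \<in> std_monos n d" using assms(2) by (auto simp: mci_lower_def split: if_splits)
  then obtain j where j: "j < n" "f (c(j := c j + 1)) \<noteq> 0"
    using assms(2) by (auto simp: mci_lower_def elim!: sum.not_neutral_contains_not_neutral)
  then have "mono_deg n (c(j := c j + 1)) = i" using assms(1) by (auto simp: mci_graded_def)
  then show ?thesis using mono_deg_upd[OF j(1), of c "c j + 1"] c by simp
qed

text \<open>Moving the lowering operator past \<open>m + 1\<close> raising operators collects the
  weights t - 2(i + k) for k = 0, ..., m, whose sum is (m + 1)(t - 2i - m).\<close>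

lemma mci_lower_mult_lin_funpow:
  fixes f :: "(nat \<Rightarrow> nat) \<Rightarrow> 'a::field"
  assumes f: "f \<in> mci_graded n d i" and t: "t = (\<Sum>j<n. d j - 1)"
  shows "mci_lower n d ((mci_mult_lin n d (\<lambda>_. 1) ^^ Suc m) f) =
    (mci_mult_lin n d (\<lambda>_. 1) ^^ Suc m) (mci_lower n d f)
    + (\<lambda>c. of_nat (Suc m) * (of_nat t - 2 * of_nat i - of_nat m) * (mci_mult_lin n d (\<lambda>_. 1) ^^ m) f c)"
proof -
  let ?E = "mci_mult_lin n d (\<lambda>_. 1 :: 'a)"
  have step: "mci_lower n d (?E g) = ?E (mci_lower n d g) + (\<lambda>c. (of_nat t - 2 * of_nat k) * g c)"
    if g: "g \<in> mci_graded n d k" for g k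
  proof
    fix c
    show "mci_lower n d (?E g) c = (?E (mci_lower n d g) + (\<lambda>c. (of_nat t - 2 * of_nat k) * g c)) c"
    proof (cases "c \<in> std_monos n d")
      case True
      then show ?thesis using mci_lower_mult_lin_commutator[OF True, of g] g t
        by (cases "g c = 0") (auto simp: mci_graded_def)
    next
      case False
      then have "g c = 0" using g by (auto simp: mci_graded_def)
      then show ?thesis using False by (simp add: mci_lower_def mci_mult_lin_def)
    qed
  qed
  show ?thesis
  proof (induction m)
    case 0
    show ?case using step[OF f] by simp
  next
    case (Suc m)
    have "mci_lower n d ((?E ^^ Suc (Suc m)) f) = ?E (mci_lower n d ((?E ^^ Suc m) f))
        + (\<lambda>c. (of_nat t - 2 * of_nat (i + Suc m)) * (?E ^^ Suc m) f c)"
      using step[OF mci_mult_lin_funpow_graded[OF f, of "Suc m" "\<lambda>_. 1"]] by simp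
    also have "?E (mci_lower n d ((?E ^^ Suc m) f)) = (?E ^^ Suc (Suc m)) (mci_lower n d f)
        + (\<lambda>c. of_nat (Suc m) * (of_nat t - 2 * of_nat i - of_nat m) * (?E ^^ Suc m) f c)"
      unfolding Suc mci_mult_lin_add mci_mult_lin_scale by simp
    finally show ?case by (simp add: fun_eq_iff algebra_simps)
  qed
qed

text \<open>The primitive-vector argument for sl2: the integers that have to be invertible
  are products of positive numbers at most t.\<close>

lemma mci_mult_lin_kernel_small_socle:
  fixes v :: "(nat \<Rightarrow> nat) \<Rightarrow> 'a::field"
  assumes t: "t = (\<Sum>j<n. d j - 1)" and p: "prime CHAR('a)" "t < CHAR('a)"
    and "v \<in> mci_graded n d i" "2 * i + m \<le> t" "(mci_mult_lin n d (\<lambda>_. 1) ^^ m) v = 0"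
  shows "v = 0"
  using assms(4-6)
proof (induction i arbitrary: v m)
  let ?E = "mci_mult_lin n d (\<lambda>_. 1 :: 'a)"
  \<comment> \<open>For a primitive vector, lowering the power \<open>Suc m\<close> gives a nonzero
    multiple of the power \<open>m\<close>, so vanishing descends to \<open>v\<close>
    itself.\<close>
  have primitive: "v = 0" if v: "v \<in> mci_graded n d i" and F: "mci_lower n d v = 0"
    and "2 * i + m \<le> t" "(?E ^^ m) v = 0" for v i m
    using that(3,4)
  proof (induction m)
    case (Suc m)
    have "(\<lambda>c. of_nat (Suc m) * (of_nat t - 2 * of_nat i - of_nat m) * (?E ^^ m) v c) = 0"
      using mci_lower_mult_lin_funpow[OF v t, of m] unfolding Suc.prems(2) F
      by (simp add: mci_lower_0 mci_mult_lin_funpow_0 del: funpow.simps)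
    moreover have "of_nat (Suc m) * (of_nat t - 2 * of_nat i - of_nat m) \<noteq> (0::'a)"
    proof -
      have "of_nat (Suc m) * (of_nat t - 2 * of_nat i - of_nat m) = (of_nat (Suc m * (t - 2 * i - m)) :: 'a)"
      proof -
        obtain k where "t = 2 * i + m + k" using Suc.prems(1) le_Suc_ex[of "2 * i + m" t] by auto
        then show ?thesis by (simp add: algebra_simps)
      qed
      moreover have "\<not> CHAR('a) dvd Suc m * (t - 2 * i - m)"
        using Suc.prems(1) p by (auto simp: prime_dvd_mult_iff dest!: dvd_imp_le simp del: mult_Suc)
      ultimately show ?thesis by (simp only: of_nat_eq_0_iff_char_dvd not_False_eq_True)
    qed
    ultimately have "(?E ^^ m) v = 0" by (simp add: fun_eq_iff)
    then show ?case using Suc by simp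
  qed simp
  {
    case 0
    have "mci_lower n d v = 0"
      using mci_lower_graded[OF 0(1)] by (auto simp: fun_eq_iff)
    then show ?case using primitive 0 by blast
  next
    case (Suc i)
    \<comment> \<open>The powers \<open>?k\<close> and \<open>Suc ?k\<close> both kill
      \<open>v\<close>, so the commutator formula shows that \<open>Suc ?k\<close> kills the
      lowering of \<open>v\<close>. By induction that lowering is zero, so \<open>v\<close> is
      primitive.\<close>
    let ?k = "t - 2 * Suc i"
    have "(?E ^^ ?k) v = 0"
    proof -
      have "?k = (?k - m) + m" using Suc.prems by simp
      then have "(?E ^^ ?k) v = (?E ^^ (?k - m)) ((?E ^^ m) v)" by (metis funpow_add o_apply)
      then show ?thesis unfolding Suc.prems(3) mci_mult_lin_funpow_0 .
    qed
    then have E1: "(?E ^^ Suc ?k) v = 0" "(?E ^^ ?k) v = 0" by (simp_all only: funpow.simps o_apply mci_mult_lin_0)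
    have z: "(?E ^^ Suc ?k) (mci_lower n d v) = 0"
      using mci_lower_mult_lin_funpow[OF Suc.prems(1) t, of ?k] unfolding E1
      by (simp add: mci_lower_0 fun_eq_iff)
    have g: "mci_lower n d v \<in> mci_graded n d i"
      using mci_lower_graded[OF Suc.prems(1)] by (auto simp: mci_graded_def)
    have "2 * i + Suc ?k \<le> t" using Suc.prems(2) by simp
    from Suc.IH[OF g this z] have "mci_lower n d v = 0" .
    then show ?case using primitive[OF Suc.prems(1) _ Suc.prems(2,3)] by blast
  }
qed

section \<open>One large exponent\<close>

text \<open>In the sum of the x_j^p every term with j \<ge> 1 is zero in A because d_j \<le> p, so
  only x_0^p acts.\<close>

lemma mci_mult_lin_frobenius_one_large:
  fixes f :: "(nat \<Rightarrow> nat) \<Rightarrow> 'a::field"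
  assumes p: "prime CHAR('a)" "p = CHAR('a)" and n: "0 < n"
    and small: "\<forall>i\<in>{1..<n}. d i \<le> p"
  shows "((mci_mult_lin n d (\<lambda>_. 1) ^^ p) ^^ Suc N) f =
    (\<lambda>c. if c \<in> std_monos n d \<and> Suc N * p \<le> c 0 then f (c(0 := c 0 - Suc N * p)) else 0)"
proof -
  have base: "(mci_mult_lin n d (\<lambda>_. 1) ^^ p) f =
    (\<lambda>c. if c \<in> std_monos n d \<and> p \<le> c 0 then f (c(0 := c 0 - p)) else 0)" for f :: "(nat \<Rightarrow> nat) \<Rightarrow> 'a"
  proof
    fix c
    have "(\<Sum>j<n. if p \<le> c j then 1 ^ p * f (c(j := c j - p)) else 0)
        = (\<Sum>j\<in>{0}. if p \<le> c j then 1 ^ p * f (c(j := c j - p)) else 0)" if c: "c \<in> std_monos n d"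
    proof (intro sum.mono_neutral_right ballI)
      fix j assume j: "j \<in> {..<n} - {0}"
      then have "d j \<le> p" using small by simp
      moreover have "c j < d j" using c j by (simp add: std_monos_def)
      ultimately show "(if p \<le> c j then 1 ^ p * f (c(j := c j - p)) else 0) = 0" by simp
    qed (use n in auto)
    then show "(mci_mult_lin n d (\<lambda>_. 1) ^^ p) f c =
        (if c \<in> std_monos n d \<and> p \<le> c 0 then f (c(0 := c 0 - p)) else 0)"
      using mci_mult_lin_frobenius[OF p(1), of p 1 n d "\<lambda>_. 1" f] p(2) by simp
  qed
  show ?thesis
  proof (induction N)
    case 0
    show ?case using base[of f] by (simp add: fun_eq_iff)
  next
    case (Suc N)
    show ?case
      by (subst funpow.simps(2), subst o_apply, subst Suc, subst base) (auto simp: fun_eq_iff std_monos_decrease)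
  qed
qed

lemma std_monos_shrink:
  assumes "0 < n" "r \<le> d 0"
  shows "c \<in> std_monos n (d(0 := r)) \<longleftrightarrow> c \<in> std_monos n d \<and> c 0 < r"
  using assms by (auto simp: std_monos_def split: if_splits)

text \<open>Cutting off at x_0^r is the quotient map of A that replaces \<open>d 0\<close> by
  \<open>r\<close>. Coefficients of a product with x_0-exponent below \<open>r\<close> depend on
  such coefficients only.\<close>

lemma mci_mult_lin_restrict:
  fixes f :: "(nat \<Rightarrow> nat) \<Rightarrow> 'a::field"
  assumes "0 < n" "r \<le> d 0"
  shows "(mci_mult_lin n (d(0 := r)) l ^^ m) (\<lambda>c. if c 0 < r then f c else 0)
    = (\<lambda>c. if c 0 < r then (mci_mult_lin n d l ^^ m) f c else 0)"
proof (induction m)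
  case (Suc m)
  have "mci_mult_lin n (d(0 := r)) l (\<lambda>c. if c 0 < r then g c else 0)
    = (\<lambda>c. if c 0 < r then mci_mult_lin n d l g c else 0)" for g
    by (auto simp: mci_mult_lin_def std_monos_shrink[of n r d, OF assms] fun_eq_iff intro!: sum.cong)
  then show ?case using Suc by (simp only: funpow.simps o_apply)
qed (simp add: fun_eq_iff)

text \<open>A power of x_0 is divisible by no monomials except powers of x_0, so its coefficient is
  carried along unchanged.\<close>

lemma mci_mult_lin_funpow_pure_power:
  assumes n: "0 < n" and m: "k + m < d 0" and d: "\<And>j. j < n \<Longrightarrow> 0 < d j"
  shows "(mci_mult_lin n d (\<lambda>_. 1) ^^ m) f ((\<lambda>_. 0)(0 := k + m)) = f ((\<lambda>_. 0)(0 := k))"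
  using m
proof (induction m)
  case (Suc m)
  let ?c = "(\<lambda>_. 0)(0 := k + Suc m) :: nat \<Rightarrow> nat"
  let ?g = "(mci_mult_lin n d (\<lambda>_. 1) ^^ m) f"
  have "?c \<in> std_monos n d" using Suc.prems n d by (auto simp: std_monos_def)
  then have "mci_mult_lin n d (\<lambda>_. 1) ?g ?c = (\<Sum>j<n. if 1 \<le> ?c j then 1 * ?g (?c(j := ?c j - 1)) else 0)"
    unfolding mci_mult_lin_def by simp
  also have "\<dots> = (\<Sum>j\<in>{0}. if 1 \<le> ?c j then 1 * ?g (?c(j := ?c j - 1)) else 0)"
    using n by (intro sum.mono_neutral_right) auto
  also have "\<dots> = ?g ((\<lambda>_. 0)(0 := k + m))" by simp
  also have "\<dots> = f ((\<lambda>_. 0)(0 := k))" by (rule Suc.IH) (use Suc.prems in simp)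
  finally show ?case by (simp only: funpow.simps o_apply)
qed simp

text \<open>The (Np)-th power of the linear form is multiplication by the (Np)-th power of the first
  variable, which reduces degrees i with 2 i < r + s to the exponents (r, d 1, ...) of socle degree
  r - 1 + s < p.  From degree s up to the middle all graded pieces have the same dimension.\<close>

lemma mci_mult_lin_kernel_one_large:
  fixes v :: "(nat \<Rightarrow> nat) \<Rightarrow> 'a::field"
  assumes p: "prime CHAR('a)" "p = CHAR('a)" and n: "0 < n"
    and d: "\<And>j. j < n \<Longrightarrow> 0 < d j"
    and small: "\<forall>i\<in>{1..<n}. d i \<le> p"
    and d0: "d 0 = N * p + r" "0 < N" "0 < r"
    and s: "s = (\<Sum>i\<in>{1..<n}. d i - 1)" "s \<le> r" "s + r \<le> p"
    and t: "t = (\<Sum>i<n. d i - 1)"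
    and v: "v \<in> mci_graded n d i" and i: "2 * i \<le> t"
    and ker: "(mci_mult_lin n d (\<lambda>_. 1) ^^ (t - 2 * i)) v = 0"
  shows "v = 0"
proof -
  let ?E = "mci_mult_lin n d (\<lambda>_. 1 :: 'a)"
  have split0: "(\<Sum>i<n. f i) = f 0 + (\<Sum>i\<in>{1..<n}. f i)" for f :: "nat \<Rightarrow> nat"
  proof -
    have "{..<n} = insert 0 {1..<n}" using n by auto
    then show ?thesis by simp
  qed
  define t0 where "t0 = r - 1 + s"
  have t': "t = N * p + t0" using d0 s t split0[of "\<lambda>i. d i - 1"] by (simp add: t0_def)
  have t0: "t0 < p" "2 * s \<le> Suc t0" using s d0 by (auto simp: t0_def)
  have frob: "(?E ^^ (N * p)) f =
      (\<lambda>c. if c \<in> std_monos n d \<and> N * p \<le> c 0 then f (c(0 := c 0 - N * p)) else 0)" for f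
    using mci_mult_lin_frobenius_one_large[OF p n small, of "N - 1" f] d0(2)
    by (simp add: funpow_mult mult.commute fun_eq_iff)
  \<comment> \<open>As \<open>d 0 = N * p + r\<close>, monomials with x_0-exponent below
    \<open>r\<close> survive multiplication by x_0^(Np).\<close>
  have shift: "w c = 0" if w: "(?E ^^ (N * p)) w = 0" and c: "c \<in> std_monos n d" "c 0 < r" for w c
  proof -
    have "c(0 := c 0 + N * p) \<in> std_monos n d"
      using c n d0 by (intro std_monos_increase) auto
    then have "(?E ^^ (N * p)) w (c(0 := c 0 + N * p)) = w c" unfolding frob by simp
    then show ?thesis using w by simp
  qed
  have low: "v = 0" if v: "v \<in> mci_graded n d i" and i: "2 * i \<le> t0"
    and ker: "(?E ^^ (t - 2 * i)) v = 0" for v i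
  proof -
    have "t - 2 * i = N * p + (t0 - 2 * i)" using t' i by simp
    then have "(?E ^^ (N * p)) ((?E ^^ (t0 - 2 * i)) v) = 0" using ker by (simp add: funpow_add)
    note z = shift[OF this]
    have "(\<lambda>c. if c 0 < r then (?E ^^ (t0 - 2 * i)) v c else 0) = 0"
      using z mci_mult_lin_funpow_graded[OF v, of "t0 - 2 * i" "\<lambda>_. 1"]
      by (auto simp: fun_eq_iff mci_graded_def)
    then have kz: "(mci_mult_lin n (d(0 := r)) (\<lambda>_. 1) ^^ (t0 - 2 * i)) (\<lambda>c. if c 0 < r then v c else 0) = 0"
      using mci_mult_lin_restrict[OF n, of r d "t0 - 2 * i" "\<lambda>_. 1" v] d0 by simp
    have "t0 = (\<Sum>j<n. (d(0 := r)) j - 1)"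
      unfolding split0 using s by (simp add: t0_def)
    moreover have "(\<lambda>c. if c 0 < r then v c else 0) \<in> mci_graded n (d(0 := r)) i"
      using v std_monos_shrink[OF n, of r d] d0 by (auto simp: mci_graded_def)
    ultimately have "(\<lambda>c. if c 0 < r then v c else 0) = 0"
      using mci_mult_lin_kernel_small_socle[OF _ p(1) _ _ _ kz] t0 p(2) i by simp
    then have small0: "v c = 0" if "c 0 < r" for c using that by (auto simp: fun_eq_iff split: if_splits)
    \<comment> \<open>From \<open>2 * i \<le> t0\<close> and \<open>s \<le> r\<close> follows
      \<open>i < r\<close>, so the cut-off at \<open>r\<close> loses no coefficient of
      \<open>v\<close>.\<close>
    have "v c = 0" for c
    proof (rule ccontr)
      assume nz: "v c \<noteq> 0"
      then have "mono_deg n c = i" using v by (auto simp: mci_graded_def)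
      moreover have "c 0 \<le> mono_deg n c" unfolding mono_deg_def split0 by simp
      ultimately show False using small0[of c] nz i s d0 by (force simp: t0_def)
    qed
    then show ?thesis by (simp add: fun_eq_iff)
  qed
  have at_s: "v = 0" if v: "v \<in> mci_graded n d s" and ker: "(?E ^^ (t - 2 * s)) v = 0" for v
  proof (cases "2 * s \<le> t0")
    case True
    then show ?thesis using low v ker by blast
  next
    case False
    \<comment> \<open>In this boundary case the power \<open>t - 2 * s\<close> is
      \<open>N * p - 1\<close>, one short of the Frobenius power. After one more multiplication
      \<open>shift\<close> leaves just the coefficient of x_0^r, which the given power carries to
      x_0^(d_0 - 1), where it must vanish.\<close>
    then have "r = s" using s(2) by (auto simp: t0_def)
    moreover have "0 < N * p" using d0(2) p by (simp add: prime_gt_0_nat)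
    ultimately have rs: "r = s" "Suc (t - 2 * s) = N * p" using t' d0(3) by (auto simp: t0_def)
    have "(?E ^^ (N * p)) v = 0"
      unfolding rs(2)[symmetric] using ker by (simp add: mci_mult_lin_0)
    note z = shift[OF this]
    have top: "v ((\<lambda>_. 0)(0 := r)) = 0"
    proof -
      have "r + (t - 2 * s) < d 0" using rs d0 by simp
      from mci_mult_lin_funpow_pure_power[of n r "t - 2 * s" d, OF n this d, of v] show ?thesis
        unfolding ker by simp
    qed
    have "v c = 0" for c
    proof (rule ccontr)
      assume nz: "v c \<noteq> 0"
      then have c: "c \<in> std_monos n d" "mono_deg n c = r" using v rs by (auto simp: mci_graded_def)
      with z nz have "r \<le> c 0" by (meson not_le)
      then have "c 0 = r" "(\<Sum>j\<in>{1..<n}. c j) = 0" using c(2) unfolding mono_deg_def split0 by auto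
      then have "c = (\<lambda>_. 0)(0 := r)" using c(1) by (auto simp: std_monos_def fun_eq_iff)
      then show False using top nz by simp
    qed
    then show ?thesis by (simp add: fun_eq_iff)
  qed
  show ?thesis
  proof (cases "2 * i \<le> t0")
    case True
    then show ?thesis using low v ker by blast
  next
    case False
    then have si: "s \<le> i" using t0 by simp
    \<comment> \<open>Lifting \<open>v\<close> back to \<open>w\<close> in degree \<open>s\<close>
      moves the kernel question there: the power \<open>t - 2 * s\<close> then kills
      \<open>w\<close>.\<close>
    have "(?E ^^ (i - s)) ` mci_graded n d s = mci_graded n d (s + (i - s))"
    proof (rule mci_mult_lin_funpow_surj)
      fix w :: "(nat \<Rightarrow> nat) \<Rightarrow> 'a"
      assume w: "w \<in> mci_graded n d s" "(?E ^^ (i - s)) w = 0"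
      have "t - 2 * s = (t - i - s) + (i - s)" using si i by simp
      then have "(?E ^^ (t - 2 * s)) w = (?E ^^ (t - i - s)) ((?E ^^ (i - s)) w)"
        by (metis funpow_add o_apply)
      then show "w = 0" using at_s w by (simp add: mci_mult_lin_funpow_0)
    next
      \<comment> \<open>The other variables contribute at most \<open>s\<close>, so x_0^(i-s)
        divides every monomial of degree \<open>i\<close>; dividing by it compares the
        dimensions.\<close>
      have large: "i - s \<le> c 0" if "c \<in> std_monos_deg n d i" for c
      proof -
        have "(\<Sum>j\<in>{1..<n}. c j) \<le> s"
          unfolding s using that by (intro sum_mono) (fastforce simp: std_monos_deg_def std_monos_def)
        moreover have "c 0 + (\<Sum>j\<in>{1..<n}. c j) = i"
          using that unfolding std_monos_deg_def mono_deg_def split0 by simp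
        ultimately show ?thesis by simp
      qed
      show "card (std_monos_deg n d (s + (i - s))) \<le> card (std_monos_deg n d s)"
      proof (rule card_inj_on_le[OF _ _ finite_std_monos_deg])
        show "inj_on (\<lambda>c. c(0 := c 0 - (i - s))) (std_monos_deg n d (s + (i - s)))"
        proof (intro inj_onI ext)
          fix a b j assume a: "a \<in> std_monos_deg n d (s + (i - s))" and b: "b \<in> std_monos_deg n d (s + (i - s))"
            and e: "a(0 := a 0 - (i - s)) = b(0 := b 0 - (i - s))"
          show "a j = b j"
            using fun_cong[OF e, of j] large[of a] large[of b] a b si by (auto split: if_splits)
        qed
        show "(\<lambda>c. c(0 := c 0 - (i - s))) ` std_monos_deg n d (s + (i - s)) \<subseteq> std_monos_deg n d s"
        proof (intro image_subsetI)
          fix c assume c: "c \<in> std_monos_deg n d (s + (i - s))"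
          then have "i - s \<le> c 0" "mono_deg n c = i" using large[of c] si by (auto simp: std_monos_deg_def)
          then have "mono_deg n (c(0 := c 0 - (i - s))) = s"
            using mono_deg_upd[OF n, of c "c 0 - (i - s)"] si by simp
          then show "c(0 := c 0 - (i - s)) \<in> std_monos_deg n d s"
            using c std_monos_decrease[of c n d 0] by (simp add: std_monos_deg_def)
        qed
      qed
    qed
    then obtain w where w: "w \<in> mci_graded n d s" "v = (?E ^^ (i - s)) w" using v si by auto
    have "t - 2 * s = (i - s) + (t - 2 * i + (i - s))" using si i by simp
    then have "(?E ^^ (t - 2 * s)) w = (?E ^^ (i - s)) ((?E ^^ (t - 2 * i)) v)"
      unfolding w(2) by (metis funpow_add o_apply)
    then have "w = 0" using at_s w(1) ker by (simp add: mci_mult_lin_funpow_0)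
    then show ?thesis using w(2) by (simp add: mci_mult_lin_funpow_0)
  qed
qed

section \<open>The classification\<close>

lemma sum_three_le:
  fixes w :: "nat \<Rightarrow> nat"
  assumes "a < n" "b < n" "c < n" "a \<noteq> b" "a \<noteq> c" "b \<noteq> c"
  shows "w a + w b + w c \<le> (\<Sum>i<n. w i)"
proof -
  have "(\<Sum>i\<in>{a,b,c}. w i) \<le> (\<Sum>i<n. w i)" using assms by (intro sum_mono2) auto
  then show ?thesis using assms by simp
qed

text \<open>Two even exponents have weight at least 1 each for q = 2. Otherwise at most one is even,
  and for q = 4 every weight is at least 1 and those of odd exponents at least 2, so three variables
  reach 4.\<close>

lemma not_mci_SLP_char_2:
  assumes n: "3 \<le> n" and d: "\<forall>i<n. 2 \<le> d i" and p: "CHAR('a::field) = 2"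
  shows "\<not> mci_SLP TYPE('a) n d"
proof (cases "\<exists>a<n. \<exists>b<n. a \<noteq> b \<and> even (d a) \<and> even (d b)")
  case True
  then obtain a b where ab: "a < n" "b < n" "a \<noteq> b" "even (d a)" "even (d b)" by blast
  let ?w = "\<lambda>i. if d i \<le> 2 then (d i - 1) mod 2 else max ((d i - 1) mod 2) (2 - 2 - (d i - 1) mod 2)"
  have w: "1 \<le> ?w i" if "i < n" "even (d i)" for i
  proof -
    have "2 \<le> d i" using d that by blast
    then have "(d i - 1) mod 2 = 1" using that(2) by presburger
    then show ?thesis by simp
  qed
  have "(\<Sum>i\<in>{a,b}. ?w i) \<le> (\<Sum>i<n. ?w i)" using ab by (intro sum_mono2) auto
  then have "2 \<le> (\<Sum>i<n. ?w i)" using w[OF ab(1,4)] w[OF ab(2,5)] ab(3) by simp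
  then show ?thesis
    using d p by (intro not_mci_SLP_if_residues_large[where q = 2 and e = 1 and w = ?w]) (auto intro: order_trans[of 1 2])
next
  case False
  define w where "w i = (if d i \<le> 4 then (d i - 1) mod 4 else max ((d i - 1) mod 4) (4 - 2 - (d i - 1) mod 4))" for i
  have w1: "1 \<le> w i" if "i < n" for i
  proof -
    have "2 \<le> d i" using d that by blast
    show ?thesis
    proof (cases "d i \<le> 4")
      case True
      with \<open>2 \<le> d i\<close> have "(d i - 1) mod 4 = d i - 1" by simp
      then show ?thesis using True \<open>2 \<le> d i\<close> by (simp add: w_def)
    qed (auto simp: w_def)
  qed
  have w2: "2 \<le> w i" if "i < n" "odd (d i)" for i
  proof -
    have "2 \<le> d i" using d that by blast
    from that(2) obtain k where k: "d i = 2 * k + 1" by (rule oddE)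
    have "(d i - 1) mod 4 = 2 * (k mod 2)" using mod_mult_mult1[of 2 k 2] k by simp
    then have "(d i - 1) mod 4 = 2 \<or> (d i - 1) mod 4 = 0 \<and> 4 < d i"
      using \<open>2 \<le> d i\<close> k by (cases "even k") (auto elim!: evenE simp: odd_iff_mod_2_eq_one)
    then show ?thesis by (auto simp: w_def)
  qed
  have "4 \<le> (\<Sum>i<n. w i)"
  proof -
    have lt: "0 < n" "1 < n" "2 < n" using n by auto
    have ne: "odd (d a) \<or> odd (d b)" if "a < n" "b < n" "a \<noteq> b" for a b
      using False that by blast
    have "4 \<le> w 0 + w 1 + w 2"
      using ne[OF lt(1,2)] ne[OF lt(1,3)] ne[OF lt(2,3)]
        w1[OF lt(1)] w1[OF lt(2)] w1[OF lt(3)] w2[OF lt(1)] w2[OF lt(2)] w2[OF lt(3)]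
      by auto
    also have "\<dots> \<le> (\<Sum>i<n. w i)" using lt by (intro sum_three_le) auto
    finally show ?thesis .
  qed
  then show ?thesis
    using d p by (intro not_mci_SLP_if_residues_large[where q = 4 and e = 2 and w = w]) (auto simp: w_def intro: order_trans[of 1 2])
qed

text \<open>For p \<ge> 3 the two numbers add up to at least the odd number p - 2, so the larger is
  at least (p - 1)/2. This bounds the weight of every exponent above p.\<close>

lemma residue_weight_ge_half:
  fixes p u :: nat
  assumes "odd p"
  shows "p - 1 \<le> 2 * max u (p - 2 - u)"
proof -
  from assms obtain k where "p = 2 * k + 1" by (rule oddE)
  then show ?thesis by (cases "k \<le> u") auto
qed

theorem theorem3p8:
  fixes n p N1 r1 :: nat and d :: "nat \<Rightarrow> nat"
  assumes "3 \<le> n"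
    and "\<forall>i<n. 2 \<le> d i"
    and "CHAR('a::field) = p" and "0 < p"
    and "\<forall>i<n. d i \<le> d 0"
    and "d 0 = N1 * p + r1" and "0 < r1" and "r1 \<le> p"
  shows "mci_SLP TYPE('a) n d \<longleftrightarrow>
    ((\<Sum>i<n. d i - 1) < p \<or>
     (d 0 > p \<and> (\<forall>i\<in>{1..<n}. d i \<le> p) \<and>
      (\<Sum>i\<in>{1..<n}. d i - 1) \<le> min r1 (p - r1)))" (is "?SLP \<longleftrightarrow> ?small \<or> ?large")
proof
  have p: "prime CHAR('a)" using prime_CHAR_semidom[where ?'a = 'a] assms(3,4) by simp
  have n: "0 < n" using assms(1) by simp
  have d1: "1 \<le> d i" "0 < d i" if "i < n" for i using assms(2) that by force+
  {
    assume "?small \<or> ?large"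
    then show ?SLP
    proof
      assume small: ?small
      show ?SLP
      proof (rule mci_SLP_if_injective[OF refl, where l = "\<lambda>_. 1"])
        fix i and v :: "(nat \<Rightarrow> nat) \<Rightarrow> 'a"
        let ?t = "\<Sum>j<n. d j - 1"
        assume "2 * i \<le> ?t" and v: "v \<in> mci_graded n d i"
          "(mci_mult_lin n d (\<lambda>_. 1) ^^ (?t - 2 * i)) v = 0"
        then have "2 * i + (?t - 2 * i) \<le> ?t" by simp
        then show "v = 0"
          using mci_mult_lin_kernel_small_socle[OF refl p _ v(1) _ v(2)] small assms(3) by blast
      qed
    next
      assume large: ?large
      have N1: "0 < N1" using large assms(6,8) by (cases N1) auto
      have s: "(\<Sum>i\<in>{1..<n}. d i - 1) \<le> r1" "(\<Sum>i\<in>{1..<n}. d i - 1) + r1 \<le> p"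
        using large assms(8) by auto
      show ?SLP
        using mci_mult_lin_kernel_one_large[OF p assms(3)[symmetric] n d1(2) _ assms(6) N1 assms(7)
            refl s refl] large
        by (intro mci_SLP_if_injective[OF refl, where l = "\<lambda>_. 1"]) blast
    qed
  }
  {
    assume slp: ?SLP
    show "?small \<or> ?large"
    proof (rule ccontr)
      assume neg: "\<not> (?small \<or> ?large)"
      have "p \<noteq> 2" using not_mci_SLP_char_2[OF assms(1,2)] assms(3) slp by blast
      then have p3: "3 \<le> p" using prime_ge_2_nat[of p] p assms(3) by simp
      then have odd: "odd p" using prime_odd_nat[of p] p assms(3) by simp
      define w where "w i = (if d i \<le> p then (d i - 1) mod p
          else max ((d i - 1) mod p) (p - 2 - (d i - 1) mod p))" for i
      have wsmall: "w i = d i - 1" if "i < n" "d i \<le> p" for i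
        using that d1[of i] by (simp add: w_def)
      have wlarge: "p - 1 \<le> 2 * w i" if "p < d i" for i
        using that residue_weight_ge_half[OF odd] by (simp add: w_def)
      have "p \<le> (\<Sum>i<n. w i)"
      proof (cases "p < d 0")
        case False
        then have "d i \<le> p" if "i < n" for i using assms(5) that by (meson le_trans not_le)
        then have "(\<Sum>i<n. w i) = (\<Sum>i<n. d i - 1)" using wsmall by (intro sum.cong) auto
        then show ?thesis using neg by simp
      next
        case True
        show ?thesis
        proof (cases "\<forall>i\<in>{1..<n}. d i \<le> p")
          case all: True
          define s where "s = (\<Sum>i\<in>{1..<n}. d i - 1)"
          \<comment> \<open>The weight of the large exponent is the larger of \<open>r1 - 1\<close>
            and \<open>p - 1 - r1\<close>; the second completes \<open>s > r1\<close> to a sum of at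
            least \<open>p\<close>, the first \<open>s > p - r1\<close>.\<close>
          have "s > r1 \<or> s > p - r1" using neg True all by (auto simp: s_def)
          moreover have "(d 0 - 1) mod p = r1 - 1"
          proof -
            have "d 0 - 1 = (r1 - 1) + N1 * p" using assms(6,7) by simp
            then show ?thesis using assms(7,8) by (simp only: mod_mult_self1) simp
          qed
          then have "w 0 = max (r1 - 1) (p - 2 - (r1 - 1))" using True by (simp add: w_def)
          moreover have "(\<Sum>i<n. w i) = w 0 + s"
          proof -
            have "{..<n} = insert 0 {1..<n}" using n by auto
            moreover have "(\<Sum>i\<in>{1..<n}. w i) = s"
              unfolding s_def using all wsmall by (intro sum.cong) auto
            ultimately show ?thesis by simp
          qed
          ultimately show ?thesis using assms(7,8) by (auto simp: max_def)
        next
          case False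
          \<comment> \<open>Two exponents above \<open>p\<close> contribute at least
            \<open>p - 1\<close> together, and a third variable \<open>j\<close> supplies the
            missing 1.\<close>
          then obtain k where "k \<in> {1..<n}" "p < d k" by (meson not_le)
          then have k: "0 < k" "k < n" "p < d k" by auto
          define j where "j = (if k = 1 then 2 else 1 :: nat)"
          have j: "j < n" "j \<noteq> 0" "j \<noteq> k" using assms(1) by (auto simp: j_def)
          have "1 \<le> w j"
          proof (cases "d j \<le> p")
            case True
            moreover have "2 \<le> d j" using assms(2) j(1) by blast
            ultimately show ?thesis using wsmall[OF j(1)] by simp
          next
            case False
            then show ?thesis using wlarge[of j] p3 by simp
          qed
          then have "p \<le> w 0 + w k + w j" using wlarge[OF True] wlarge[OF k(3)] by linarith
          also have "\<dots> \<le> (\<Sum>i<n. w i)" using j k n by (intro sum_three_le) auto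
          finally show ?thesis .
        qed
      qed
      then have "\<not> ?SLP"
        using d1(1) assms(3) by (intro not_mci_SLP_if_residues_large[OF p, where q = p and e = 1 and w = w]) (auto simp: w_def)
      then show False using slp by blast
    qed
  }
qed

end
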